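(* Let $G$ be a dicot game and let $H$ be a binary game such that no follower of $H$ has misère outcome $\mathcal L$. Then $G \geqslant^-_{\mathcal{D}} H$ if and only if $G \geqslant^-_{\mathcal{DB}} H$.
   Context: A game is a finite two-player combinatorial game, defined recursively by $G=\{G^{\mathbf L}\mid G^{\mathbf R}\}$, where $G^{\mathbf L}$ and $G^{\mathbf R}$ are the finite sets of Left options and Right options, which are themselves games. The game $0=\{\cdot\mid\cdot\}$ has no options. A follower of $G$ is a game reachable from $G$ by a (possibly empty) succession of not necessarily alternating Left and Right moves; in particular $G$ is a follower of itself. The sum is $G+H=\{G^{\mathbf L}+H,\,G+H^{\mathbf L}\mid G^{\mathbf R}+H,\,G+H^{\mathbf R}\}$. Left and Right alternate moves. Under misère play, a player who cannot move on their turn wins. The misère outcome $o^-(G)$ is $\mathcal L$ (Left wins whoever starts), $\mathcal R$ (Right wins whoever starts), $\mathcal N$ (the first player wins) or $\mathcal P$ (the second player wins). Outcomes are partially ordered by $\mathcal R<\mathcal N<\mathcal L$ and $\mathcal R<\mathcal P<\mathcal L$, with $\mathcal N$ and $\mathcal P$ incomparable. For a set $\mathcal U$ of games and games $G,H$ (not necessarily in $\mathcal U$), $G\geqslant^-_{\mathcal U}H$ means $o^-(G+X)\geqslant o^-(H+X)$ for every $X\in\mathcal U$. A game is dicot if it is $0$, or if it has both Left and Right options and all of them are dicot. A game is binary if it has at most one Left option and at most one Right option, and all these options, if any, are binary. $\mathcal D$ is the set of all dicot games and $\mathcal{DB}$ is the set of all games that are both binary and dicot. *)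

theory Defs
  imports "HOL-Library.FSet"
begin

datatype game =
  Game (left_opts: "game fset") (right_opts: "game fset")

datatype player = Left | Right

fun opponent :: "player \<Rightarrow> player" where
  "opponent Left = Right"
| "opponent Right = Left"

fun options :: "player \<Rightarrow> game \<Rightarrow> game fset" where
  "options Left G = left_opts G"
| "options Right G = right_opts G"

lemma size_left_option:
  assumes "G' |\<in>| left_opts G"
  shows "size G' < size G"
proof (cases G)
  case (Game A B)
  then have "Suc (size G') \<le> (\<Sum>x\<in>fset A. Suc (size x))"
    using assms by (intro member_le_sum) auto
  then show ?thesis
    using Game by simp
qed

lemma size_right_option:
  assumes "G' |\<in>| right_opts G"
  shows "size G' < size G"
proof (cases G)
  case (Game A B)
  then have "Suc (size G') \<le> (\<Sum>x\<in>fset B. Suc (size x))"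
    using assms by (intro member_le_sum) auto
  then show ?thesis
    using Game by simp
qed

lemma size_option: "G' |\<in>| options p G \<Longrightarrow> size G' < size G"
  by (cases p) (auto intro: size_left_option size_right_option)

instantiation game :: "{zero, plus}"
begin

definition zero_game :: game where
  "0 = Game {||} {||}"

function plus_game :: "game \<Rightarrow> game \<Rightarrow> game" where
  "plus_game G H =
     Game ((\<lambda>G'. plus_game G' H) |`| left_opts G |\<union>| (\<lambda>H'. plus_game G H') |`| left_opts H)
          ((\<lambda>G'. plus_game G' H) |`| right_opts G |\<union>| (\<lambda>H'. plus_game G H') |`| right_opts H)"
  by pat_completeness auto
termination
  by (relation "measure (\<lambda>(G, H). size G + size H)")
     (auto simp: size_left_option size_right_option)

declare plus_game.simps [simp del]

instance ..

end

text \<open>\<open>misere_wins p q G\<close>: under misere play, player \<open>p\<close> can force a win in \<open>G\<close> when player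
  \<open>q\<close> moves first.  A player who cannot move on their turn wins.\<close>

function misere_wins :: "player \<Rightarrow> player \<Rightarrow> game \<Rightarrow> bool" where
  "misere_wins p q G \<longleftrightarrow>
     (if p = q
      then options q G = {||} \<or> (\<exists>G' |\<in>| options q G. misere_wins p (opponent q) G')
      else options q G \<noteq> {||} \<and> (\<forall>G' |\<in>| options q G. misere_wins p (opponent q) G'))"
  by pat_completeness auto
termination
  by (relation "measure (\<lambda>(p, q, G). size G)") (auto simp: size_option)

declare misere_wins.simps [simp del]

lemma misere_determined: "misere_wins (opponent p) q G \<longleftrightarrow> \<not> misere_wins p q G"
proof (induction G arbitrary: q rule: measure_induct_rule[of size])
  case (less G)
  have opp: "opponent p = q \<longleftrightarrow> p \<noteq> q"
    by (cases p; cases q) auto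
  have IH: "misere_wins (opponent p) (opponent q) G' \<longleftrightarrow> \<not> misere_wins p (opponent q) G'"
    if "G' |\<in>| options q G" for G'
    using less size_option[OF that] by blast
  show ?case
    unfolding misere_wins.simps[of _ q G] opp using IH by auto
qed

datatype outcome = Outcome_L | Outcome_R | Outcome_N | Outcome_P

text \<open>By \<open>misere_determined\<close>, the last case of the following definition is exactly the case in
  which the player moving second can force a win (lemma \<open>misere_outcome_eq_P_iff\<close>).\<close>

definition misere_outcome :: "game \<Rightarrow> outcome" where
  "misere_outcome G =
     (if misere_wins Left Left G \<and> misere_wins Left Right G then Outcome_L
      else if misere_wins Right Left G \<and> misere_wins Right Right G then Outcome_R
      else if misere_wins Left Left G \<and> misere_wins Right Right G then Outcome_N
      else Outcome_P)"

lemma misere_outcome_eq_P_iff: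
  "misere_outcome G = Outcome_P \<longleftrightarrow> misere_wins Right Left G \<and> misere_wins Left Right G"
  using misere_determined[of Left Left G] misere_determined[of Left Right G]
  by (auto simp: misere_outcome_def)

instantiation outcome :: order
begin

definition less_eq_outcome :: "outcome \<Rightarrow> outcome \<Rightarrow> bool" where
  "a \<le> b \<longleftrightarrow> a = b \<or> a = Outcome_R \<or> b = Outcome_L"

definition less_outcome :: "outcome \<Rightarrow> outcome \<Rightarrow> bool" where
  "a < b \<longleftrightarrow> a \<le> b \<and> \<not> b \<le> (a :: outcome)"

instance
  by standard (auto simp: less_eq_outcome_def less_outcome_def)

end

inductive follower :: "game \<Rightarrow> game \<Rightarrow> bool" for G :: game where
  refl: "follower G G"
| step: "follower G K \<Longrightarrow> K' |\<in>| options p K \<Longrightarrow> follower G K'"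

inductive dicot :: "game \<Rightarrow> bool" where
  zero: "dicot 0"
| options: "(\<And>p. options p G \<noteq> {||}) \<Longrightarrow> (\<And>p G'. G' |\<in>| options p G \<Longrightarrow> dicot G') \<Longrightarrow> dicot G"

inductive binary :: "game \<Rightarrow> bool" where
  "(\<And>p. fcard (options p G) \<le> 1) \<Longrightarrow> (\<And>p G'. G' |\<in>| options p G \<Longrightarrow> binary G') \<Longrightarrow> binary G"

definition dicot_games :: "game set" where
  "dicot_games = {G. dicot G}"

definition dicot_binary_games :: "game set" where
  "dicot_binary_games = {G. dicot G \<and> binary G}"

text \<open>\<open>misere_ge U G H\<close>: the game \<open>G\<close> is at least as good as \<open>H\<close> (for Left) modulo \<open>U\<close>; neither
  \<open>G\<close> nor \<open>H\<close> need belong to \<open>U\<close>.\<close>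

definition misere_ge :: "game set \<Rightarrow> game \<Rightarrow> game \<Rightarrow> bool" where
  "misere_ge U G H \<longleftrightarrow> (\<forall>X\<in>U. misere_outcome (G + X) \<ge> misere_outcome (H + X))"

end

theory Submission
  imports Defs
begin

text \<open>
  Up to the treatment of ends, the adjoint \<open>H\<degree> = {(H\<^sup>R)\<degree> | (H\<^sup>L)\<degree>}\<close> of a binary game \<open>H\<close> is a binary
  dicot game such that Left wins \<open>H + H\<degree>\<close> moving second, so \<open>G \<ge> H\<close> modulo binary dicots forces
  Left to win \<open>G + H\<degree>\<close> moving second.  Reading Left's replies in \<open>G + H\<degree>\<close> as replies in the
  comparison of \<open>G\<close> with \<open>H\<close> then yields \<open>G \<ge> H\<close> modulo all dicots, by induction.  Two points need
  care.  Where \<open>H\<close> has no Right option, \<open>H\<degree>\<close> still needs a Left option; we take a binary dicot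
  game \<open>Z\<close> so bad for Left that she loses by moving to it.  The induction also meets the case where
  \<open>G\<close> and the test game are both \<open>0\<close> and Left wins \<open>H\<close> moving second; since \<open>H\<close> does not have
  outcome \<open>\<L>\<close>, Left then loses \<open>H\<close> moving first, and as \<open>H\<close> is binary, Right's winning line
  in \<open>H\<close>, mirrored in \<open>H\<degree>\<close>, leads to \<open>Z\<close>, so that Left loses \<open>0 + H\<degree>\<close>.
\<close>

section \<open>Moves in sums, outcomes, and closure of dicot and binary games\<close>

lemma left_opts_zero [simp]: "left_opts 0 = {||}"
  and right_opts_zero [simp]: "right_opts 0 = {||}"
  by (simp_all add: zero_game_def)

lemma left_opts_plus:
  "left_opts (G + H) = (\<lambda>G'. G' + H) |`| left_opts G |\<union>| (\<lambda>H'. G + H') |`| left_opts H"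
  by (subst plus_game.simps) simp

lemma right_opts_plus:
  "right_opts (G + H) = (\<lambda>G'. G' + H) |`| right_opts G |\<union>| (\<lambda>H'. G + H') |`| right_opts H"
  by (subst plus_game.simps) simp

lemma plus_zero_right [simp]: "G + 0 = (G :: game)"
proof (induction G)
  case (Game A B)
  then show ?case
    by (subst plus_game.simps) (simp add: fset.map_ident_strong)
qed

lemma left_wins_first_iff:
  "misere_wins Left Left G \<longleftrightarrow>
     left_opts G = {||} \<or> (\<exists>G' |\<in>| left_opts G. misere_wins Left Right G')"
  by (subst misere_wins.simps) simp

lemma left_wins_second_iff:
  "misere_wins Left Right G \<longleftrightarrow>
     right_opts G \<noteq> {||} \<and> (\<forall>G' |\<in>| right_opts G. misere_wins Left Left G')"
  by (subst misere_wins.simps) simp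

text \<open>An outcome records whether Left wins moving first and moving second, and the order is
  componentwise, so each starting player can be treated separately.\<close>

lemma misere_outcome_le_iff:
  "misere_outcome H \<le> misere_outcome G \<longleftrightarrow>
     (\<forall>q. misere_wins Left q H \<longrightarrow> misere_wins Left q G)"
proof -
  have right: "misere_wins Right q K \<longleftrightarrow> \<not> misere_wins Left q K" for q K
    using misere_determined[of Left q K] by simp
  have all: "(\<forall>q. P q) \<longleftrightarrow> P Left \<and> P Right" for P
    by (metis player.exhaust)
  show ?thesis
    by (auto simp: all misere_outcome_def less_eq_outcome_def right)
qed

lemma misere_outcome_eq_L_iff:
  "misere_outcome G = Outcome_L \<longleftrightarrow> misere_wins Left Left G \<and> misere_wins Left Right G"
  by (auto simp: misere_outcome_def)

lemma follower_opt:
  assumes "follower H' K" and "H' |\<in>| options p H"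
  shows "follower H K"
  using assms by (induction rule: follower.induct) (auto intro: follower.intros)

lemma dicot_opt:
  assumes "dicot G" and "G' |\<in>| options p G"
  shows "dicot G'"
  using assms(1)
proof cases
  case zero
  then show ?thesis
    using assms(2) by (cases p) auto
qed (use assms(2) in blast)

lemma dicot_left_opts: "dicot G \<Longrightarrow> G' |\<in>| left_opts G \<Longrightarrow> dicot G'"
  using dicot_opt[of G G' Left] by simp

lemma dicot_right_opts: "dicot G \<Longrightarrow> G' |\<in>| right_opts G \<Longrightarrow> dicot G'"
  using dicot_opt[of G G' Right] by simp

lemma dicot_end:
  assumes "dicot G" and "options p G = {||}"
  shows "G = 0"
  using assms by cases auto

lemma dicot_Game:
  assumes "A \<noteq> {||}" "B \<noteq> {||}" "\<And>G. G |\<in>| A \<Longrightarrow> dicot G" "\<And>G. G |\<in>| B \<Longrightarrow> dicot G"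
  shows "dicot (Game A B)"
proof (rule dicot.options)
  show "options p (Game A B) \<noteq> {||}" for p
    using assms by (cases p) auto
  show "dicot G" if "G |\<in>| options p (Game A B)" for p G
    using assms that by (cases p) auto
qed

lemma binary_Game:
  assumes "fcard A \<le> 1" "fcard B \<le> 1" "\<And>G. G |\<in>| A \<Longrightarrow> binary G" "\<And>G. G |\<in>| B \<Longrightarrow> binary G"
  shows "binary (Game A B)"
proof (rule binary.intros)
  show "fcard (options p (Game A B)) \<le> 1" for p
    using assms by (cases p) auto
  show "binary G" if "G |\<in>| options p (Game A B)" for p G
    using assms that by (cases p) auto
qed

lemma binary_zero: "binary 0"
  unfolding zero_game_def by (rule binary_Game) (auto simp: fcard.rep_eq)

lemma binary_opt: "binary G \<Longrightarrow> G' |\<in>| options p G \<Longrightarrow> binary G'"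
  by (erule binary.cases) auto

lemma fcard_options_binary: "binary G \<Longrightarrow> fcard (options p G) \<le> 1"
  by (erule binary.cases) auto

lemma binary_opt_unique:
  assumes "binary G" "K |\<in>| options p G" "K' |\<in>| options p G"
  shows "K = K'"
proof -
  have "card (fset (options p G)) \<le> Suc 0"
    using fcard_options_binary[OF assms(1)] by (simp add: fcard.rep_eq)
  then show ?thesis
    using assms by (auto simp: card_le_Suc0_iff_eq)
qed

section \<open>A binary dicot to which Left loses by moving\<close>

definition star :: game where
  "star = Game {|0|} {|0|}"

text \<open>The source of \<open>Z\<close>. Left needs \<open>k + 1\<close> moves to reach
  \<open>0\<close>; until then Right can move to \<open>star\<close>, which alone is lost for Left
  moving first, since her move to \<open>0\<close> leaves Right stuck and winning.\<close>

primrec right_heavy :: "nat \<Rightarrow> game" where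
  "right_heavy 0 = Game {|0|} {|star|}"
| "right_heavy (Suc k) = Game {|right_heavy k|} {|star|}"

lemma dicot_right_heavy: "dicot (right_heavy k)"
  by (induction k) (auto intro!: dicot_Game dicot.zero simp: star_def)

lemma binary_right_heavy: "binary (right_heavy k)"
  by (induction k) (auto intro!: binary_Game binary_zero simp: star_def fcard_finsert_if)

lemma right_opts_right_heavy [simp]: "right_opts (right_heavy k) = {|star|}"
  by (cases k) auto

text \<open>Right plays in \<open>G\<close> until it is exhausted, by which time Left has not been able to run down
  the long chain of Left moves.\<close>

lemma right_wins_plus_right_heavy:
  assumes "dicot G"
  shows "size G \<le> Suc k \<Longrightarrow> \<not> misere_wins Left Right (G + right_heavy k)"
    and "size G \<le> k \<Longrightarrow> \<not> misere_wins Left Left (G + right_heavy k)"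
  using assms
proof (induction "size G + k" arbitrary: G k rule: less_induct)
  case less
  {
    case 1
    show ?case
    proof (cases "G = 0")
      case True
      have "\<not> misere_wins Left Left (0 + star)"
        by (subst left_wins_first_iff)
          (simp add: left_opts_plus star_def left_wins_second_iff[of 0])
      then show ?thesis
        using True by (auto simp: left_wins_second_iff[of "0 + _"] right_opts_plus)
    next
      case False
      then obtain G' where G': "G' |\<in>| right_opts G"
        using dicot_end[of G Right] 1 by auto
      then have "\<not> misere_wins Left Left (G' + right_heavy k)"
        using less(2)[of G' k] size_right_option[OF G'] 1 dicot_right_opts by auto
      then show ?thesis
        using G' by (auto simp: left_wins_second_iff[of "G + _"] right_opts_plus)
    qed
  next
    case 2
    \<comment> \<open>Even \<open>0\<close> has positive size, so \<open>k\<close> is not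
      \<open>0\<close>, and Left's move in the chain reaches \<open>right_heavy k'\<close> rather
      than \<open>0\<close>.\<close>
    have "size G > 0"
      by (cases G) simp
    then obtain k' where k: "k = Suc k'"
      using 2 by (cases k) auto
    have "\<not> misere_wins Left Right (G' + right_heavy k)" if "G' |\<in>| left_opts G" for G'
      using less(1)[of G' k] size_left_option[OF that] 2 dicot_left_opts that by auto
    moreover have "\<not> misere_wins Left Right (G + right_heavy k')"
      using less(1)[of G k'] k 2 by auto
    ultimately show ?case
      using k by (auto simp: left_wins_first_iff[of "G + _"] left_opts_plus)
  }
qed

section \<open>The adjoint and play in sums with it\<close>

text \<open>Both sides are filled to make a dicot. The filler \<open>0\<close> is harmless to Left
  in \<open>H + adjoint Z H\<close>: it occurs only when \<open>H\<close> has no Left option, and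
  Right's move to it leaves her stuck in \<open>H\<close>, hence winning.\<close>

function adjoint :: "game \<Rightarrow> game \<Rightarrow> game" where
  "adjoint Z H =
     Game (if right_opts H = {||} then {|Z|} else adjoint Z |`| right_opts H)
          (if left_opts H = {||} then {|0|} else adjoint Z |`| left_opts H)"
  by pat_completeness auto
termination
  by (relation "measure (\<lambda>(Z, H). size H)") (auto simp: size_left_option size_right_option)

declare adjoint.simps [simp del]

lemma left_opts_adjoint:
  "left_opts (adjoint Z H) =
     (if right_opts H = {||} then {|Z|} else adjoint Z |`| right_opts H)"
  by (subst adjoint.simps) simp

lemma right_opts_adjoint:
  "right_opts (adjoint Z H) =
     (if left_opts H = {||} then {|0|} else adjoint Z |`| left_opts H)"
  by (subst adjoint.simps) simp

lemma dicot_adjoint: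
  assumes "dicot Z"
  shows "dicot (adjoint Z H)"
proof (induction H rule: measure_induct_rule[of size])
  case (less H)
  show ?case
    by (subst adjoint.simps, rule dicot_Game)
      (auto intro: less size_left_option size_right_option assms dicot.zero split: if_splits)
qed

lemma binary_adjoint:
  assumes "binary Z" and "binary H"
  shows "binary (adjoint Z H)"
  using assms(2)
proof (induction H rule: measure_induct_rule[of size])
  case (less H)
  have card: "fcard (adjoint Z |`| options p H) \<le> 1" for p
    using fcard_options_binary[OF less.prems, of p] card_image_le[of "fset (options p H)" "adjoint Z"]
    by (simp add: fcard.rep_eq)
  have bin: "binary (adjoint Z K)" if "K |\<in>| options p H" for p K
    using less that size_option binary_opt by blast
  show ?case
    by (subst adjoint.simps, rule binary_Game)
      (use card[of Left] card[of Right] bin[of _ Left] bin[of _ Right] in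
        \<open>auto simp: assms(1) binary_zero fcard_finsert_if split: if_splits\<close>)
qed

text \<open>Left mirrors each move of Right in the other component, and Right is never stuck because
  the adjoint has a Right option. Left never moves to \<open>Z\<close>, so \<open>Z\<close> is
  arbitrary here.\<close>

lemma left_wins_second_plus_adjoint: "misere_wins Left Right (H + adjoint Z H)"
proof (induction H rule: measure_induct_rule[of size])
  case (less H)
  have "misere_wins Left Left (K + adjoint Z H)" if K: "K |\<in>| right_opts H" for K
  proof -
    have "adjoint Z K |\<in>| left_opts (adjoint Z H)"
      using K by (auto simp: left_opts_adjoint)
    then show ?thesis
      using less[OF size_right_option[OF K]]
      by (auto simp: left_wins_first_iff[of "K + _"] left_opts_plus)
  qed
  moreover have "misere_wins Left Left (H + adjoint Z K)" if K: "K |\<in>| left_opts H" for K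
    using less[OF size_left_option[OF K]] K
    by (auto simp: left_wins_first_iff[of "H + _"] left_opts_plus)
  moreover have "misere_wins Left Left (H + 0)" if "left_opts H = {||}"
    using that by (simp add: left_wins_first_iff)
  ultimately show ?case
    by (auto simp: left_wins_second_iff[of "H + _"] right_opts_plus right_opts_adjoint
        split: if_splits)
qed

lemma left_wins_first_plus_adjoint:
  assumes "misere_wins Left Left (G + adjoint Z H)"
    and "\<not> misere_wins Left Right (G + Z)"
  shows "(\<exists>G' |\<in>| left_opts G. misere_wins Left Right (G' + adjoint Z H)) \<or>
         (\<exists>H' |\<in>| right_opts H. misere_wins Left Right (G + adjoint Z H'))"
  using assms
  by (auto simp: left_wins_first_iff[of "G + _"] left_opts_plus left_opts_adjoint split: if_splits)

lemma right_opt_plus_adjoint: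
  assumes "misere_wins Left Right (G + adjoint Z H)" and "G' |\<in>| right_opts G"
  shows "misere_wins Left Left (G' + adjoint Z H)"
  using assms by (auto simp: left_wins_second_iff[of "G + _"] right_opts_plus)

lemma plus_right_opt_adjoint:
  assumes "misere_wins Left Right (G + adjoint Z H)"
  shows "H' |\<in>| left_opts H \<Longrightarrow> misere_wins Left Left (G + adjoint Z H')"
    and "left_opts H = {||} \<Longrightarrow> misere_wins Left Left G"
  using assms
  by (auto simp: left_wins_second_iff[of "G + _"] right_opts_plus right_opts_adjoint
      split: if_splits)

lemma right_wins_zero_plus_adjoint:
  assumes "binary H" and "\<not> misere_wins Left Left H" and Z: "\<not> misere_wins Left Right (0 + Z)"
  shows "\<not> misere_wins Left Right (0 + adjoint Z H)"
  using assms(1,2)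
proof (induction H rule: measure_induct_rule[of size])
  case (less H)
  show ?case
  proof
    assume win: "misere_wins Left Right (0 + adjoint Z H)"
    obtain H' where H': "H' |\<in>| left_opts H" "\<not> misere_wins Left Right H'"
      using less.prems by (auto simp: left_wins_first_iff[of H])
    obtain K where K: "K |\<in>| right_opts H'" "misere_wins Left Right (0 + adjoint Z K)"
      using left_wins_first_plus_adjoint[OF plus_right_opt_adjoint(1)[OF win H'(1)] Z] by auto
    have bin: "binary H'" "binary K"
      using binary_opt[OF less.prems(1), of H' Left] binary_opt[of H' K Right] H'(1) K(1) by simp_all
    \<comment> \<open>Right is not stuck in \<open>H'\<close>, so he has a winning move there; as
      \<open>H'\<close> is binary, that move is to \<open>K\<close>.\<close>
    have "\<not> misere_wins Left Left K"
      using H'(2) K(1) binary_opt_unique[OF bin(1), of _ Right]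
      by (auto simp: left_wins_second_iff[of H'])
    moreover have "size K < size H"
      using size_left_option[OF H'(1)] size_right_option[OF K(1)] by simp
    ultimately show False
      using less.IH bin(2) K(2) by blast
  qed
qed

section \<open>From one sum with the adjoint to all dicot test games\<close>

text \<open>The bound \<open>n\<close> lets a single \<open>Z\<close> serve the whole induction, in
  which \<open>G\<close> only shrinks.\<close>

lemma misere_wins_plus_mono_of_adjoint:
  assumes Z: "\<And>G. dicot G \<Longrightarrow> size G \<le> n \<Longrightarrow> \<not> misere_wins Left Right (G + Z)"
    and "dicot G" "size G \<le> n" "binary H" "dicot X"
    and "\<And>K. follower H K \<Longrightarrow> misere_outcome K \<noteq> Outcome_L"
    and "misere_wins Left Right (G + adjoint Z H)"
    and "misere_wins Left q (H + X)"
  shows "misere_wins Left q (G + X)"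
  using assms(2-)
proof (induction "size G + size H + size X" arbitrary: G H X q rule: less_induct)
  case less
  note G = less.prems(1,2) and adj = less.prems(6)
  \<comment> \<open>The second alternative covers a move by one player and a reply by the other in
    the same component.\<close>
  have H_opt: "binary K \<and> size K < size H \<and> (\<forall>M. follower K M \<longrightarrow> misere_outcome M \<noteq> Outcome_L)"
    if "K |\<in>| options p H \<or> K |\<in>| options p H' \<and> H' |\<in>| options p' H" for K H' p p'
    using that less.prems(3,5) binary_opt size_option follower_opt by (meson less_trans)
  have G_opt: "dicot K \<and> size K < size G"
    if "K |\<in>| options p G \<or> K |\<in>| options p G' \<and> G' |\<in>| options p' G" for K G' p p'
    using that G dicot_opt size_option by (meson less_trans)
  show ?case
  proof (cases q)
    case Left
    consider (stuck) "left_opts H = {||}" "left_opts X = {||}"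
      | (X) X' where "X' |\<in>| left_opts X" "misere_wins Left Right (H + X')"
      | (H) H' where "H' |\<in>| left_opts H" "misere_wins Left Right (H' + X)"
      using less.prems(7) Left by (auto simp: left_wins_first_iff[of "H + _"] left_opts_plus)
    then show ?thesis
    proof cases
      case stuck
      then have "X = 0"
        using dicot_end[of X Left] less.prems(4) by simp
      then show ?thesis
        using plus_right_opt_adjoint(2)[OF adj] stuck Left by simp
    next
      case X
      have "misere_wins Left Right (G + X')"
        using less.hyps[of G H X'] less.prems X size_left_option dicot_left_opts by simp
      then show ?thesis
        using X Left by (auto simp: left_wins_first_iff[of "G + _"] left_opts_plus)
    next
      case H
      \<comment> \<open>Left's move from \<open>H\<close> to \<open>H'\<close> is turned into
        Right's move to \<open>adjoint Z H'\<close>; Left has a winning answer to it, which is not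
        the move to \<open>Z\<close>.\<close>
      consider G' where "G' |\<in>| left_opts G" "misere_wins Left Right (G' + adjoint Z H')"
        | K where "K |\<in>| right_opts H'" "misere_wins Left Right (G + adjoint Z K)"
        using left_wins_first_plus_adjoint[OF plus_right_opt_adjoint(1)[OF adj H(1)]] Z G by blast
      then show ?thesis
      proof cases
        case 1
        have "misere_wins Left Right (G' + X)"
          using less.hyps[of G' H' X Right] less.prems(4) G(2) 1 H H_opt[of H' Left] G_opt[of G' Left]
          by auto
        then show ?thesis
          using 1 Left by (auto simp: left_wins_first_iff[of "G + _"] left_opts_plus)
      next
        case 2
        \<comment> \<open>Left's answer \<open>adjoint Z K\<close> corresponds to Right moving from
          \<open>H'\<close> to \<open>K\<close>. Left is again to move, with \<open>G\<close> and
          \<open>X\<close> unchanged, so induction applies to \<open>G + X\<close> itself.\<close>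
        have "misere_wins Left Left (K + X)"
          using H(2) 2(1) by (auto simp: left_wins_second_iff[of "H' + _"] right_opts_plus)
        then show ?thesis
          using less.hyps[of G K X Left] less.prems(4) G 2 H H_opt[of K Right H' Left] Left by auto
      qed
    qed
  next
    case Right
    have HX: "misere_wins Left Right (H + X)"
      using less.prems(7) Right by simp
    \<comment> \<open>A stuck Right would win. Excluding this is what the hypothesis on the outcomes
      of followers of \<open>H\<close> is for.\<close>
    have "right_opts (G + X) \<noteq> {||}"
    proof
      assume "right_opts (G + X) = {||}"
      then have "G = 0" "X = 0"
        using dicot_end[of _ Right] less.prems(1,4) by (auto simp: right_opts_plus)
      moreover have "\<not> misere_wins Left Left H"
        using less.prems(5)[OF follower.refl] HX \<open>X = 0\<close> by (simp add: misere_outcome_eq_L_iff)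
      ultimately show False
        using right_wins_zero_plus_adjoint[of H Z] less.prems(3) adj Z G by blast
    qed
    moreover have "misere_wins Left Left (G + X')" if X': "X' |\<in>| right_opts X" for X'
    proof -
      have "misere_wins Left Left (H + X')"
        using HX X' by (auto simp: left_wins_second_iff[of "H + _"] right_opts_plus)
      then show ?thesis
        using less.hyps[of G H X' Left] less.prems X' size_right_option dicot_right_opts by simp
    qed
    moreover have "misere_wins Left Left (G' + X)" if G': "G' |\<in>| right_opts G" for G'
    proof -
      have "\<not> misere_wins Left Right (G' + Z)"
        using Z[of G'] G_opt[of G' Right] G' G by auto
      \<comment> \<open>Left's answer to \<open>G'\<close> is either copied in
        \<open>G' + X\<close>, or read as a Right move from \<open>H\<close> to \<open>H'\<close>,
        after which Left wins \<open>H' + X\<close> moving first.\<close>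
      then consider K where "K |\<in>| left_opts G'" "misere_wins Left Right (K + adjoint Z H)"
        | H' where "H' |\<in>| right_opts H" "misere_wins Left Right (G' + adjoint Z H')"
        using left_wins_first_plus_adjoint[OF right_opt_plus_adjoint[OF adj G']] by blast
      then show ?thesis
      proof cases
        case 1
        have "misere_wins Left Right (K + X)"
          using less.hyps[of K H X Right] less.prems(3-5) HX G(2) 1 G' G_opt[of K Left G' Right]
          by auto
        then show ?thesis
          using 1 by (auto simp: left_wins_first_iff[of "G' + _"] left_opts_plus)
      next
        case 2
        have "misere_wins Left Left (H' + X)"
          using HX 2(1) by (auto simp: left_wins_second_iff[of "H + _"] right_opts_plus)
        then show ?thesis
          using less.hyps[of G' H' X Left] less.prems(4) G(2) 2 G' H_opt[of H' Right]
            G_opt[of G' Right] by auto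
      qed
    qed
    ultimately show ?thesis
      using Right by (auto simp: left_wins_second_iff[of "G + _"] right_opts_plus)
  qed
qed

theorem theorem3p17:
  fixes G H :: game
  assumes "dicot G" and "binary H"
    and "\<And>K. follower H K \<Longrightarrow> misere_outcome K \<noteq> Outcome_L"
  shows "misere_ge dicot_games G H \<longleftrightarrow> misere_ge dicot_binary_games G H"
proof
  assume "misere_ge dicot_games G H"
  then show "misere_ge dicot_binary_games G H"
    by (auto simp: misere_ge_def dicot_games_def dicot_binary_games_def)
next
  assume ge: "misere_ge dicot_binary_games G H"
  \<comment> \<open>The chain is long enough for every dicot of size at most
    \<open>size G\<close>.\<close>
  define Z where "Z = right_heavy (size G)"
  have "adjoint Z H \<in> dicot_binary_games"
    using assms(2)
    by (simp add: Z_def dicot_binary_games_def dicot_adjoint binary_adjoint dicot_right_heavy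
        binary_right_heavy)
  then have adj: "misere_wins Left Right (G + adjoint Z H)"
    using ge left_wins_second_plus_adjoint[of H Z]
    by (auto simp: misere_ge_def misere_outcome_le_iff)
  have "\<not> misere_wins Left Right (K + Z)" if "dicot K" "size K \<le> size G" for K
    using right_wins_plus_right_heavy(1)[of K "size G"] that by (simp add: Z_def)
  then have "misere_wins Left q (G + X)" if "dicot X" "misere_wins Left q (H + X)" for q X
    using misere_wins_plus_mono_of_adjoint[OF _ assms(1) order_refl assms(2) that(1) assms(3) adj
        that(2)] by blast
  then show "misere_ge dicot_games G H"
    by (auto simp: misere_ge_def dicot_games_def misere_outcome_le_iff)
qed

end
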